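(* Let $G=(V,E)$ be a connected, undirected simple graph, let $i\in V$ and $f\in E$. Then the constraint $$\sum_{e\in\delta(i)}y_{fe}\geq x_f$$ is a Chv\'atal-Gomory cut with respect to the mixed-integer semidefinite program (MISDP) for the quadratic minimum spanning tree problem on $G$ given in the context.
   Context: Let $n=|V|$, $m=|E|$, with a fixed ordering of $E$, and put $\beta=2(1-\cos(\pi/n))$, $\alpha=\beta/n$. $\mathcal{S}^k$ denotes the real symmetric $k\times k$ matrices, $\mathbf{1}$ the all-ones vector, $\mathbf{J}_n$ the all-ones matrix, $\mathbf{I}_n$ the identity matrix; $\succeq\mathbf{0}$ means positive semidefinite; $\langle X,Y\rangle=\mathrm{tr}(XY)$; $\mathrm{diag}(Y)$ is the vector of diagonal entries and $\mathrm{Diag}(v)$ the diagonal matrix with diagonal $v$. $\delta(i)$ is the set of edges incident to the vertex $i$. For $X=(x_{ij})\in\mathcal{S}^n$ supported on $E$, $\mathcal{B}(X)\in\mathbb{R}^m$ is the vector of entries $x_e:=x_{ij}$, $e=\{i,j\}\in E$. The MISDP for the quadratic minimum spanning tree problem with cost matrix $Q\in\mathcal{S}^m$ is: minimize $\langle Q,Y\rangle$ over $Y=(y_{ef})\in\mathcal{S}^m$ (rows and columns indexed by $E$) and $X\in\{0,1\}^{n\times n}\cap\mathcal{S}^n$ with $\langle X,\mathbf{J}_n\rangle=2(n-1)$ and $x_{ij}=0$ if $\{i,j\}\notin E$, subject to $$\mathrm{diag}(Y)=\mathcal{B}(X),\qquad \begin{pmatrix} Y & \mathcal{B}(X)\\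 \mathcal{B}(X)^\top & 1\end{pmatrix}\succeq\mathbf{0},\qquad \mathrm{Diag}(X\mathbf{1})-X+\alpha\mathbf{J}_n-\beta\mathbf{I}_n\succeq\mathbf{0}.$$ In particular $y_{ff}=x_f$. At feasible points all entries of $Y$ are in $\{0,1\}$. Its continuous (doubly nonnegative) relaxation is obtained by replacing $X\in\{0,1\}^{n\times n}$ by $X\in[0,1]^{n\times n}$ and requiring all entries of $Y$ to be nonnegative. Chv\'atal-Gomory cut: if an inequality $\sum_{e\in E}c_e x_e+\sum_{\{e,f\}\subseteq E,\,e\neq f}c_{ef}\,y_{ef}\geq d$ with integer coefficients $c_e,c_{ef}$ and $d\in\mathbb{R}$ is valid for all points of the continuous relaxation (for example, because it arises by taking the trace inner product of a linear matrix inequality of the program with a positive semidefinite matrix), then the inequality with the same left-hand side and right-hand side $\lceil d\rceil$ is a Chv\'atal-Gomory cut with respect to the MISDP. (Equivalently, for inequalities written with $\leq$, the right-hand side is rounded down.) *)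

theory Defs
  imports "HOL-Analysis.Analysis" "Graph_Theory.Pair_Digraph" "Graph_Theory.Digraph_Component"
begin

text \<open>
  The vertex set is the finite type \<open>'v\<close>, so \<open>n = CARD('v)\<close>. The edge set is
  \<open>E :: 'v set set\<close>, and \<open>lab :: 'e \<Rightarrow> 'v set\<close> with \<open>bij_betw lab UNIV E\<close> enumerates the edges
  by the finite index type \<open>'e\<close>, so \<open>m = CARD('e)\<close>. Vectors and matrices indexed by \<open>E\<close> have
  type \<open>real ^ 'e\<close> and \<open>real ^ 'e ^ 'e\<close>.
\<close>

definition simple_graph :: "'v::finite set set \<Rightarrow> bool" where
  "simple_graph E \<longleftrightarrow> (\<forall>e\<in>E. card e = 2)"

definition connected_graph :: "'v::finite set set \<Rightarrow> bool" where
  "connected_graph E \<longleftrightarrow>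
     Digraph_Component.connected (with_proj \<lparr>pverts = UNIV, parcs = {(u, v). {u, v} \<in> E}\<rparr>)"

definition incident_edges :: "('e \<Rightarrow> 'v set) \<Rightarrow> 'v \<Rightarrow> 'e set" where
  "incident_edges lab i = {e. i \<in> lab e}"


definition symmetric_matrix :: "real ^ 'n ^ 'n \<Rightarrow> bool" where
  "symmetric_matrix A \<longleftrightarrow> transpose A = A"

lemma symmetric_matrix_nth:
  assumes "symmetric_matrix A"
  shows "A $ k $ l = A $ l $ k"
proof -
  have "A $ k $ l = transpose A $ l $ k"
    by (simp add: transpose_def)
  then show ?thesis
    using assms by (simp add: symmetric_matrix_def)
qed

definition psd :: "real ^ 'n::finite ^ 'n \<Rightarrow> bool" where
  "psd A \<longleftrightarrow> symmetric_matrix A \<and> (\<forall>z. 0 \<le> z \<bullet> (A *v z))"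

definition trace_inner :: "real ^ 'n::finite ^ 'n \<Rightarrow> real ^ 'n ^ 'n \<Rightarrow> real" where
  "trace_inner A B = trace (A ** B)"

definition all_ones :: "real ^ 'n" where
  "all_ones = (\<chi> i. 1)"

definition all_ones_matrix :: "real ^ 'n ^ 'n" where
  "all_ones_matrix = (\<chi> i j. 1)"

definition diag_vec :: "real ^ 'n ^ 'n \<Rightarrow> real ^ 'n" where
  "diag_vec A = (\<chi> i. A $ i $ i)"

definition diag_matrix :: "real ^ 'n \<Rightarrow> real ^ 'n ^ 'n" where
  "diag_matrix v = (\<chi> i j. if i = j then v $ i else 0)"

text \<open>The block matrix with blocks \<open>Y\<close>, \<open>x\<close>, \<open>x\<^sup>T\<close>, \<open>1\<close>; \<open>None\<close> is the index of the extra
  row and column.\<close>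

definition bordered :: "real ^ 'e ^ 'e \<Rightarrow> real ^ 'e \<Rightarrow> real ^ 'e option ^ 'e option" where
  "bordered Y x = (\<chi> a b. case (a, b) of
       (Some e, Some f) \<Rightarrow> Y $ e $ f
     | (Some e, None) \<Rightarrow> x $ e
     | (None, Some f) \<Rightarrow> x $ f
     | (None, None) \<Rightarrow> 1)"

text \<open>The entry of a symmetric matrix at an unordered pair of indices. It is well defined for
  symmetric matrices only, see \<open>pair_entry_eq\<close>.\<close>

definition pair_entry :: "real ^ 'n ^ 'n \<Rightarrow> 'n set \<Rightarrow> real" where
  "pair_entry A p = (THE a. \<exists>i j. p = {i, j} \<and> a = A $ i $ j)"

lemma pair_entry_eq:
  assumes "symmetric_matrix A"
  shows "pair_entry A {i, j} = A $ i $ j"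
proof (unfold pair_entry_def, rule the_equality)
  show "\<exists>k l. {i, j} = {k, l} \<and> A $ i $ j = A $ k $ l"
    by blast
next
  fix a assume "\<exists>k l. {i, j} = {k, l} \<and> a = A $ k $ l"
  then show "a = A $ i $ j"
    using symmetric_matrix_nth[OF assms] by (metis doubleton_eq_iff)
qed

definition edge_vec :: "('e \<Rightarrow> 'v set) \<Rightarrow> real ^ 'v ^ 'v \<Rightarrow> real ^ 'e" where
  "edge_vec lab X = (\<chi> e. pair_entry X (lab e))"


text \<open>\<open>\<beta>\<close> and \<open>\<alpha>\<close> as functions of the number \<open>n\<close> of vertices.\<close>

definition beta :: "nat \<Rightarrow> real" where
  "beta n = 2 * (1 - cos (pi / real n))"

definition alpha :: "nat \<Rightarrow> real" where
  "alpha n = beta n / real n"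

text \<open>The variables \<open>(X, Y)\<close>, together with the requirement \<open>diag(Y) = \<B>(X)\<close> that identifies
  \<open>y\<^sub>e\<^sub>e\<close> with \<open>x\<^sub>e\<close>.\<close>

definition qmst_variables ::
  "('e::finite \<Rightarrow> 'v::finite set) \<Rightarrow> real ^ 'v ^ 'v \<Rightarrow> real ^ 'e ^ 'e \<Rightarrow> bool" where
  "qmst_variables lab X Y \<longleftrightarrow>
     symmetric_matrix X \<and> symmetric_matrix Y \<and>
     (\<forall>i j. {i, j} \<notin> range lab \<longrightarrow> X $ i $ j = 0) \<and>
     diag_vec Y = edge_vec lab X"

definition qmst_constraints ::
  "('e::finite \<Rightarrow> 'v::finite set) \<Rightarrow> real ^ 'v ^ 'v \<Rightarrow> real ^ 'e ^ 'e \<Rightarrow> bool" where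
  "qmst_constraints lab X Y \<longleftrightarrow>
     qmst_variables lab X Y \<and>
     trace_inner X all_ones_matrix = 2 * (real CARD('v) - 1) \<and>
     psd (bordered Y (edge_vec lab X)) \<and>
     psd (diag_matrix (X *v all_ones) - X
          + alpha CARD('v) *\<^sub>R all_ones_matrix - beta CARD('v) *\<^sub>R mat 1)"

definition qmst_misdp_feasible ::
  "('e::finite \<Rightarrow> 'v::finite set) \<Rightarrow> real ^ 'v ^ 'v \<Rightarrow> real ^ 'e ^ 'e \<Rightarrow> bool" where
  "qmst_misdp_feasible lab X Y \<longleftrightarrow>
     qmst_constraints lab X Y \<and> (\<forall>i j. X $ i $ j \<in> {0, 1})"

text \<open>The objective of the program, to be minimized for a symmetric cost matrix \<open>Q\<close>. Cuts depend
  on the feasible region only.\<close>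

definition qmst_objective :: "real ^ 'e::finite ^ 'e \<Rightarrow> real ^ 'e ^ 'e \<Rightarrow> real" where
  "qmst_objective Q Y = trace_inner Q Y"

definition qmst_relaxation ::
  "('e::finite \<Rightarrow> 'v::finite set) \<Rightarrow> real ^ 'v ^ 'v \<Rightarrow> real ^ 'e ^ 'e \<Rightarrow> bool" where
  "qmst_relaxation lab X Y \<longleftrightarrow>
     qmst_constraints lab X Y \<and> (\<forall>i j. X $ i $ j \<in> {0..1}) \<and> (\<forall>e f. 0 \<le> Y $ e $ f)"


text \<open>The left-hand side \<open>\<Sum>\<^sub>e c\<^sub>e x\<^sub>e + \<Sum> c\<^sub>e\<^sub>f y\<^sub>e\<^sub>f\<close>, the second sum ranging over the unordered
  pairs \<open>{e, f}\<close> with \<open>e \<noteq> f\<close>.\<close>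

definition integer_form ::
  "('e::finite \<Rightarrow> 'v::finite set) \<Rightarrow> ('e \<Rightarrow> int) \<Rightarrow> ('e set \<Rightarrow> int) \<Rightarrow>
   real ^ 'v ^ 'v \<Rightarrow> real ^ 'e ^ 'e \<Rightarrow> real" where
  "integer_form lab c c2 X Y =
     (\<Sum>e\<in>UNIV. of_int (c e) * edge_vec lab X $ e)
     + (\<Sum>p\<in>{p. card p = 2}. of_int (c2 p) * pair_entry Y p)"

text \<open>\<open>L X Y \<ge> r\<close> is a Chvatal-Gomory cut. A term \<open>y\<^sub>f\<^sub>f\<close> of \<open>L\<close> is read as \<open>x\<^sub>f\<close>, which is
  why \<open>L\<close> is compared with an integer form only where \<open>diag(Y) = \<B>(X)\<close>. This determines the
  coefficients, since the \<open>x\<^sub>e\<close> and the \<open>y\<^sub>e\<^sub>f\<close> with \<open>e \<noteq> f\<close> vary freely under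
  \<open>qmst_variables\<close>.\<close>

definition chvatal_gomory_cut ::
  "('e::finite \<Rightarrow> 'v::finite set) \<Rightarrow> (real ^ 'v ^ 'v \<Rightarrow> real ^ 'e ^ 'e \<Rightarrow> real) \<Rightarrow> int \<Rightarrow> bool" where
  "chvatal_gomory_cut lab L r \<longleftrightarrow>
     (\<exists>c c2 (d::real).
        (\<forall>X Y. qmst_variables lab X Y \<longrightarrow> L X Y = integer_form lab c c2 X Y) \<and>
        (\<forall>X Y. qmst_relaxation lab X Y \<longrightarrow> integer_form lab c c2 X Y \<ge> d) \<and>
        r = \<lceil>d\<rceil>)"


text \<open>Consistency: points of the mixed-integer program lie in the relaxation, their \<open>Y\<close> is
  integral, and a Chvatal-Gomory cut is valid for them.\<close>

lemma psd_kernel: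
  fixes A :: "real ^ 'n::finite ^ 'n"
  assumes "psd A" "z \<bullet> (A *v z) = 0"
  shows "A *v z = 0"
proof -
  define w where "w = A *v z"
  define q where "q = w \<bullet> (A *v w)"
  have sym: "x \<bullet> (A *v y) = (A *v x) \<bullet> y" for x y
    using assms(1) unfolding psd_def symmetric_matrix_def
    by (metis dot_lmul_matrix transpose_matrix_vector)
  have q: "0 \<le> q"
    using assms(1) by (simp add: psd_def q_def)
  define t where "t = (w \<bullet> w) / (q + 1)"
  have "0 \<le> (z - t *\<^sub>R w) \<bullet> (A *v (z - t *\<^sub>R w))"
    using assms(1) by (simp add: psd_def)
  also have "\<dots> = z \<bullet> (A *v z) - t * (z \<bullet> (A *v w)) - t * (w \<bullet> (A *v z)) + t * (t * q)"
    by (simp add: matrix_vector_mult_diff_distrib matrix_vector_mult_scaleR inner_diff_left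
        inner_diff_right q_def algebra_simps)
  also have "\<dots> = t * (t * q) - 2 * t * (w \<bullet> w)"
    using sym[of z w] assms(2) by (simp add: w_def)
  finally have 1: "2 * t * (w \<bullet> w) \<le> t * (t * q)"
    by simp
  have "w \<bullet> w = t * (q + 1)"
    using q by (simp add: t_def)
  then have "2 * t * (t * (q + 1)) \<le> t * (t * q)"
    using 1 by simp
  then have "t * t * (q + 2) \<le> 0"
    by (simp add: algebra_simps)
  then have "t = 0"
    using q by (smt (verit) mult_pos_pos not_real_square_gt_zero)
  then show ?thesis
    using \<open>w \<bullet> w = t * (q + 1)\<close> by (simp add: w_def)
qed

lemma edge_vec_01:
  assumes "qmst_misdp_feasible lab X Y" "simple_graph (range lab)"
  shows "edge_vec lab X $ e \<in> {0, 1}"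
proof -
  have "card (lab e) = 2"
    using assms(2) by (simp add: simple_graph_def)
  then obtain u v where "lab e = {u, v}"
    unfolding card_2_iff by blast
  then show ?thesis
    using assms(1)
    by (simp add: edge_vec_def pair_entry_eq qmst_misdp_feasible_def qmst_constraints_def
        qmst_variables_def)
qed

lemma misdp_Y_eq:
  assumes "qmst_misdp_feasible lab X Y" "simple_graph (range lab)"
  shows "Y $ e $ f = edge_vec lab X $ e * edge_vec lab X $ f"
proof -
  define x where "x = edge_vec lab X"
  define z where "z = axis (Some f) 1 - x $ f *\<^sub>R axis None (1::real)"
  have psd: "psd (bordered Y x)" and "diag_vec Y = x"
    using assms(1) by (auto simp: x_def qmst_misdp_feasible_def qmst_constraints_def qmst_variables_def)
  then have d: "Y $ f $ f = x $ f"
    by (metis diag_vec_def vec_lambda_beta)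
  have col: "bordered Y x *v z = (\<chi> a. bordered Y x $ a $ Some f - x $ f * bordered Y x $ a $ None)"
    unfolding z_def
    by (simp add: matrix_vector_mult_diff_distrib matrix_vector_mult_scaleR
        matrix_vector_mul_component vec_eq_iff inner_axis)
  have "z \<bullet> (bordered Y x *v z) = x $ f - x $ f * x $ f"
    unfolding col by (simp add: z_def inner_diff_left inner_axis' bordered_def d)
  also have "\<dots> = 0"
    using edge_vec_01[OF assms, of f] by (auto simp: x_def)
  finally have "bordered Y x *v z = 0"
    by (rule psd_kernel[OF psd])
  then have "(bordered Y x *v z) $ Some e = 0"
    by simp
  then show ?thesis
    unfolding col by (simp add: bordered_def x_def mult.commute)
qed

lemma misdp_feasible_imp_relaxation:
  assumes "qmst_misdp_feasible lab X Y" "simple_graph (range lab)"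
  shows "qmst_relaxation lab X Y"
proof -
  have "0 \<le> Y $ e $ f" for e f
    using misdp_Y_eq[OF assms, of e f] edge_vec_01[OF assms, of e] edge_vec_01[OF assms, of f] by auto
  moreover have "X $ i $ j \<in> {0..1}" for i j
  proof -
    have "X $ i $ j \<in> {0, 1}"
      using assms(1) unfolding qmst_misdp_feasible_def by blast
    then show ?thesis by auto
  qed
  ultimately show ?thesis
    using assms(1) by (simp add: qmst_misdp_feasible_def qmst_relaxation_def)
qed

lemma chvatal_gomory_cut_valid:
  assumes "chvatal_gomory_cut lab L r" "qmst_misdp_feasible lab X Y" "simple_graph (range lab)"
  shows "of_int r \<le> L X Y"
proof -
  obtain c c2 and d :: real where
    L: "\<And>X Y. qmst_variables lab X Y \<Longrightarrow> L X Y = integer_form lab c c2 X Y" and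
    d: "\<And>X Y. qmst_relaxation lab X Y \<Longrightarrow> d \<le> integer_form lab c c2 X Y" and r: "r = \<lceil>d\<rceil>"
    using assms(1) unfolding chvatal_gomory_cut_def by blast
  have var: "qmst_variables lab X Y"
    using assms(2) by (simp add: qmst_misdp_feasible_def qmst_constraints_def)
  have x: "edge_vec lab X $ e \<in> \<int>" for e
    using edge_vec_01[OF assms(2,3), of e] by auto
  have y: "pair_entry Y p \<in> \<int>" if card: "card p = 2" for p
  proof -
    obtain e f where "p = {e, f}"
      using card unfolding card_2_iff by blast
    then show ?thesis
      using var x by (simp add: pair_entry_eq qmst_variables_def misdp_Y_eq[OF assms(2,3)])
  qed
  have "integer_form lab c c2 X Y \<in> \<int>"
    unfolding integer_form_def by (intro Ints_add Ints_sum Ints_mult x Ints_of_int) (simp add: y)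
  moreover have "d \<le> integer_form lab c c2 X Y"
    using d misdp_feasible_imp_relaxation[OF assms(2,3)] by blast
  ultimately show ?thesis
    unfolding r L[OF var] by (auto elim!: Ints_cases simp: ceiling_le_iff)
qed

end

theory Submission
  imports Defs
begin

text \<open>
  Write \<open>D = \<delta>(i)\<close>. Chvatal-Gomory rounding requires a bound \<open>d\<close> with \<open>-1 < d \<le> 0\<close> such that
  \<open>(\<Sum>e\<in>D. y\<^sub>f\<^sub>e) - x\<^sub>f \<ge> d\<close> on the whole relaxation.

  Nonnegativity of \<open>Y\<close> and \<open>x\<^sub>f \<le> 1\<close> give only the bound \<open>-1\<close>, which rounds up to itself. The
  two semidefinite constraints provide the missing gap. The Laplacian constraint, tested at
  the unit vector of \<open>i\<close>, keeps the fractional degree \<open>S = (\<Sum>e\<in>D. x\<^sub>e)\<close> away from zero: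
  \<open>S \<ge> \<beta> - \<alpha> > 0\<close> (\<open>relaxation_degree_ge\<close>). The bordered constraint, tested at the vector
  with entry \<open>-1\<close> in the extra coordinate and \<open>e\<^sub>f + t 1\<^sub>D\<close> on the edges, for a unit vector
  \<open>e\<^sub>f\<close>, the indicator vector \<open>1\<^sub>D\<close> and a small \<open>t > 0\<close>, gives
  \<open>1 - x\<^sub>f + 2 t (\<Sum>e\<in>D. y\<^sub>f\<^sub>e) \<ge> 2 t S - t\<^sup>2 (\<Sum>e,e'\<in>D. y\<^sub>e\<^sub>e\<^sub>')\<close>. Here \<open>Y\<close> is itself positive
  semidefinite, so the last double sum is at most \<open>|D| S\<close>, and the term linear in \<open>t\<close> wins:
  for \<open>t = 1 / (m + 1)\<close> the right-hand side is at least \<open>t S\<close>. Since \<open>2 t \<le> 1\<close>, this yields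
  \<open>(\<Sum>e\<in>D. y\<^sub>f\<^sub>e) - x\<^sub>f \<ge> (\<beta> - \<alpha>) / (m + 1) - 1 > -1\<close> (\<open>relaxation_cut_gap\<close>).
\<close>

section \<open>Quadratic forms of positive semidefinite matrices\<close>

definition set_vec :: "'a set \<Rightarrow> real ^ 'a::finite" where
  "set_vec D = (\<chi> e. if e \<in> D then 1 else 0)"

lemma inner_set_vec: "set_vec D \<bullet> w = (\<Sum>e\<in>D. w $ e)"
  by (simp add: set_vec_def inner_vec_def if_distrib[of "\<lambda>u. u * _"] sum.If_cases cong: if_cong)

lemma matrix_mult_set_vec: "(A *v set_vec D) $ k = (\<Sum>e\<in>D. A $ k $ e)"
  using inner_set_vec[of D "A $ k"]
  by (simp add: matrix_vector_mult_def inner_vec_def mult.commute)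

lemma psd_diagonal_nonneg:
  assumes "psd A"
  shows "0 \<le> A $ k $ k"
proof -
  have "axis k 1 \<bullet> (A *v axis k 1) = A $ k $ k"
    by (simp add: inner_axis' matrix_vector_mul_component inner_axis)
  then show ?thesis
    using assms by (metis psd_def)
qed

text \<open>Testing at the difference of two unit vectors.\<close>

lemma psd_entry_le_diagonal_mean:
  assumes "psd A"
  shows "A $ k $ l \<le> (A $ k $ k + A $ l $ l) / 2"
proof -
  define z :: "real ^ 'a" where "z = axis k 1 - axis l 1"
  have "z \<bullet> (A *v z) = A $ k $ k - A $ k $ l - A $ l $ k + A $ l $ l"
    by (simp add: z_def inner_diff_left matrix_vector_mult_diff_distrib inner_axis'
        matrix_vector_mul_component inner_axis)
  moreover have "A $ l $ k = A $ k $ l"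
    using assms symmetric_matrix_nth psd_def by blast
  moreover have "0 \<le> z \<bullet> (A *v z)"
    using assms psd_def by blast
  ultimately show ?thesis by simp
qed

lemma psd_block_sum_le:
  assumes "psd A"
  shows "(\<Sum>k\<in>D. \<Sum>l\<in>D. A $ k $ l) \<le> real (card D) * (\<Sum>k\<in>D. A $ k $ k)"
proof -
  have "(\<Sum>k\<in>D. \<Sum>l\<in>D. A $ k $ l) \<le> (\<Sum>k\<in>D. \<Sum>l\<in>D. (A $ k $ k + A $ l $ l) / 2)"
    by (intro sum_mono psd_entry_le_diagonal_mean assms)
  also have "\<dots> = real (card D) * (\<Sum>k\<in>D. A $ k $ k)"
    by (simp add: add_divide_distrib sum.distrib sum_divide_distrib[symmetric]
        sum_distrib_left[symmetric])
  finally show ?thesis .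
qed

lemma bordered_quadratic_form:
  fixes Y :: "real ^ 'e::finite ^ 'e"
  defines "z \<equiv> \<lambda>s (v :: real ^ 'e). \<chi> a. case a of None \<Rightarrow> s | Some e \<Rightarrow> v $ e"
  shows "z s v \<bullet> (bordered Y x *v z s v) = v \<bullet> (Y *v v) + 2 * s * (x \<bullet> v) + s\<^sup>2"
proof -
  have split: "(\<Sum>a\<in>UNIV. g a) = g None + (\<Sum>e\<in>UNIV. g (Some e))" for g :: "'e option \<Rightarrow> real"
    by (simp add: UNIV_option_conv sum.reindex)
  show ?thesis
    by (simp add: z_def bordered_def inner_vec_def matrix_vector_mult_def split
        distrib_left sum.distrib sum_distrib_left power2_eq_square algebra_simps)
qed

lemma psd_bordered_form_nonneg:
  assumes "psd (bordered Y x)"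
  shows "0 \<le> v \<bullet> (Y *v v) + 2 * s * (x \<bullet> v) + s\<^sup>2"
  using assms bordered_quadratic_form[of s v Y x] unfolding psd_def by metis

lemma psd_bordered_imp_psd:
  assumes "psd (bordered Y x)" "symmetric_matrix Y"
  shows "psd Y"
  using assms(2) psd_bordered_form_nonneg[OF assms(1), of _ 0] by (simp add: psd_def)

text \<open>
  The test vector has entry \<open>-1\<close> in the extra coordinate and \<open>v = e\<^sub>f + t 1\<^sub>D\<close> elsewhere. The
  part without \<open>t\<close> is \<open>1 - 2 x\<^sub>f + y\<^sub>f\<^sub>f\<close>, which the condition on the diagonal collapses to
  \<open>1 - x\<^sub>f\<close>; the same condition bounds the part quadratic in \<open>t\<close> by a multiple of
  \<open>\<Sum>e\<in>D. x\<^sub>e\<close>, so that for small \<open>t\<close> the linear part dominates it.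
\<close>

lemma psd_bordered_cut_inequality:
  assumes psd: "psd (bordered Y x)" and sym: "symmetric_matrix Y" and diag: "diag_vec Y = x"
  shows "2 * t * (\<Sum>e\<in>D. x $ e) - t\<^sup>2 * (real (card D) * (\<Sum>e\<in>D. x $ e))
         \<le> 1 - x $ f + 2 * t * (\<Sum>e\<in>D. Y $ f $ e)"
proof -
  have d: "Y $ e $ e = x $ e" for e
    using diag by (metis diag_vec_def vec_lambda_beta)
  define v where "v = axis f 1 + t *\<^sub>R set_vec D"
  have "(\<Sum>e\<in>D. Y $ e $ f) = (\<Sum>e\<in>D. Y $ f $ e)"
    using symmetric_matrix_nth[OF sym] by (intro sum.cong refl) blast
  then have "v \<bullet> (Y *v v) =
      x $ f + 2 * t * (\<Sum>e\<in>D. Y $ f $ e) + t\<^sup>2 * (\<Sum>e\<in>D. \<Sum>e'\<in>D. Y $ e $ e')"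
    by (simp add: v_def inner_add_left matrix_vector_right_distrib matrix_vector_mult_scaleR
        inner_add_right inner_axis' matrix_mult_set_vec inner_set_vec d
        matrix_vector_mul_component[of Y "axis f 1"] inner_axis power2_eq_square algebra_simps)
  moreover have "x \<bullet> v = x $ f + t * (\<Sum>e\<in>D. x $ e)"
    by (simp add: v_def inner_add_right inner_axis inner_set_vec inner_commute[of x "set_vec D"])
  moreover have "0 \<le> v \<bullet> (Y *v v) + 2 * (-1) * (x \<bullet> v) + (-1)\<^sup>2"
    by (rule psd_bordered_form_nonneg[OF psd])
  moreover have "t\<^sup>2 * (\<Sum>e\<in>D. \<Sum>e'\<in>D. Y $ e $ e') \<le> t\<^sup>2 * (real (card D) * (\<Sum>e\<in>D. x $ e))"
    using psd_block_sum_le[OF psd_bordered_imp_psd[OF psd sym], of D]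
    by (intro mult_left_mono) (simp_all add: d)
  ultimately show ?thesis
    by (simp add: algebra_simps)
qed

section \<open>The fractional degree of a vertex\<close>

lemma beta_minus_alpha_pos:
  assumes "2 \<le> n"
  shows "0 < beta n - alpha n"
proof -
  have "pi / real n \<le> pi / 1"
    using assms by (intro divide_left_mono) auto
  then have "cos (pi / real n) < cos 0"
    using assms by (intro cos_monotone_0_pi) auto
  then have "0 < beta n"
    by (simp add: beta_def)
  moreover have "alpha n < beta n"
    using \<open>0 < beta n\<close> assms by (simp add: alpha_def field_simps)
  ultimately show ?thesis by simp
qed

lemma row_sum_eq_degree:
  assumes vars: "qmst_variables lab X Y" and simple: "simple_graph (range lab)" and inj: "inj lab"
  shows "(X *v all_ones) $ i = (\<Sum>e\<in>incident_edges lab i. edge_vec lab X $ e)"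
proof -
  define N where "N = {j. {i, j} \<in> range lab}"
  define g where "g j = inv lab {i, j}" for j
  have lab_g: "lab (g j) = {i, j}" if "j \<in> N" for j
    using that unfolding N_def g_def by (simp add: f_inv_into_f)
  have "inj_on g N"
  proof (rule inj_onI)
    fix j k assume "j \<in> N" "k \<in> N" "g j = g k"
    then have "{i, j} = {i, k}"
      using lab_g by metis
    then show "j = k"
      by (metis doubleton_eq_iff)
  qed
  moreover have "g ` N = incident_edges lab i"
  proof (intro equalityI subsetI)
    fix e assume "e \<in> g ` N"
    then show "e \<in> incident_edges lab i"
      using lab_g by (auto simp: incident_edges_def)
  next
    fix e assume "e \<in> incident_edges lab i"
    moreover have "card (lab e) = 2"
      using simple by (simp add: simple_graph_def)
    ultimately obtain j where j: "lab e = {i, j}"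
      unfolding incident_edges_def card_2_iff by (auto, metis insert_commute)
    then have "j \<in> N" and "g j = e"
      using inj by (auto simp: N_def g_def j[symmetric])
    then show "e \<in> g ` N" by blast
  qed
  ultimately have "bij_betw g N (incident_edges lab i)"
    by (simp add: bij_betw_def)
  then have "(\<Sum>e\<in>incident_edges lab i. edge_vec lab X $ e) = (\<Sum>j\<in>N. edge_vec lab X $ g j)"
    by (rule sum.reindex_bij_betw[symmetric])
  also have "\<dots> = (\<Sum>j\<in>N. X $ i $ j)"
    using vars lab_g by (intro sum.cong refl) (simp add: edge_vec_def pair_entry_eq qmst_variables_def)
  also have "\<dots> = (\<Sum>j\<in>UNIV. X $ i $ j)"
    using vars by (intro sum.mono_neutral_left) (auto simp: N_def qmst_variables_def)
  finally show ?thesis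
    by (simp add: matrix_vector_mult_def all_ones_def)
qed

text \<open>
  The diagonal entry at \<open>i\<close> of the Laplacian constraint is \<open>deg(i) - x\<^sub>i\<^sub>i + \<alpha> - \<beta>\<close>, and
  \<open>x\<^sub>i\<^sub>i = 0\<close> because the graph has no loops.
\<close>

lemma relaxation_degree_ge:
  fixes lab :: "'e::finite \<Rightarrow> 'v::finite set"
  assumes "qmst_relaxation lab X Y" and simple: "simple_graph (range lab)" and "inj lab"
  shows "beta CARD('v) - alpha CARD('v) \<le> (\<Sum>e\<in>incident_edges lab i. edge_vec lab X $ e)"
proof -
  have vars: "qmst_variables lab X Y"
    and psd: "psd (diag_matrix (X *v all_ones) - X
          + alpha CARD('v) *\<^sub>R all_ones_matrix - beta CARD('v) *\<^sub>R mat 1)"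
    using assms(1) by (auto simp: qmst_relaxation_def qmst_constraints_def)
  have "{i, i} \<notin> range lab"
  proof
    assume "{i, i} \<in> range lab"
    then have "card {i, i} = 2"
      using simple by (metis simple_graph_def)
    then show False by simp
  qed
  then have "X $ i $ i = 0"
    using vars by (simp add: qmst_variables_def)
  then show ?thesis
    using psd_diagonal_nonneg[OF psd, of i] row_sum_eq_degree[OF vars simple \<open>inj lab\<close>, of i]
    by (simp add: diag_matrix_def all_ones_matrix_def mat_def)
qed

section \<open>The uniform gap above the trivial bound\<close>

lemma relaxation_cut_gap:
  fixes lab :: "'e::finite \<Rightarrow> 'v::finite set"
  assumes relax: "qmst_relaxation lab X Y" and simple: "simple_graph (range lab)" and inj: "inj lab"
  shows "(beta CARD('v) - alpha CARD('v)) / (real CARD('e) + 1) - 1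
         \<le> (\<Sum>e\<in>incident_edges lab i. Y $ f $ e) - edge_vec lab X $ f"
proof -
  define D where "D = incident_edges lab i"
  define x where "x = edge_vec lab X"
  define t where "t = 1 / (real CARD('e) + 1)"
  define S where "S = (\<Sum>e\<in>D. x $ e)"
  define u where "u = (\<Sum>e\<in>D. Y $ f $ e)"
  define b where "b = beta CARD('v) - alpha CARD('v)"
  have "b \<le> S"
    unfolding S_def D_def x_def b_def by (rule relaxation_degree_ge[OF relax simple inj])
  have "1 \<le> CARD('e)"
    by (simp add: Suc_le_eq)
  then have t: "0 < t" "2 * t \<le> 1"
    by (simp_all add: t_def field_simps)
  have nonneg: "0 \<le> Y $ e $ e'" for e e'
    using relax by (simp add: qmst_relaxation_def)
  have diag: "diag_vec Y = x"
    using relax by (simp add: x_def qmst_relaxation_def qmst_constraints_def qmst_variables_def)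
  have "0 \<le> x $ e" for e
    using nonneg[of e e] diag by (metis diag_vec_def vec_lambda_beta)
  then have "0 \<le> S"
    by (simp add: S_def sum_nonneg)
  have "0 \<le> u"
    by (simp add: u_def sum_nonneg nonneg)
  have "card D \<le> CARD('e)"
    by (intro card_mono) auto
  then have "t * real (card D) \<le> 1"
    by (simp add: t_def field_simps)
  then have "t * S * (t * real (card D)) \<le> t * S * 1"
    using t \<open>0 \<le> S\<close> by (intro mult_left_mono) auto
  moreover have "2 * t * S - t\<^sup>2 * (real (card D) * S) \<le> 1 - x $ f + 2 * t * u"
    unfolding S_def u_def using relax diag
    by (intro psd_bordered_cut_inequality)
      (auto simp: x_def qmst_relaxation_def qmst_constraints_def qmst_variables_def)
  moreover have "2 * t * u \<le> 1 * u"
    using t \<open>0 \<le> u\<close> by (intro mult_right_mono) auto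
  moreover have "t * b \<le> t * S"
    using t \<open>b \<le> S\<close> by (intro mult_left_mono) auto
  ultimately have "t * b - 1 \<le> u - x $ f"
    by (simp add: power2_eq_square algebra_simps)
  then show ?thesis
    by (simp add: t_def b_def u_def x_def D_def)
qed

section \<open>The cut\<close>

text \<open>
  A term \<open>y\<^sub>f\<^sub>f\<close> of the row sum contributes to the coefficient of \<open>x\<^sub>f\<close>, the other terms to
  the coefficients of the unordered pairs \<open>{f, e}\<close>.
\<close>

lemma integer_form_row_sum:
  assumes vars: "qmst_variables lab X Y"
  shows "integer_form lab
           (\<lambda>e. if e = f then (if f \<in> D then 0 else - 1) else 0)
           (\<lambda>p. if p \<in> (\<lambda>e. {f, e}) ` (D - {f}) then 1 else 0) X Y
         = (\<Sum>e\<in>D. Y $ f $ e) - edge_vec lab X $ f"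
proof -
  let ?P = "(\<lambda>e. {f, e}) ` (D - {f})"
  have sym: "symmetric_matrix Y" and diag: "Y $ f $ f = edge_vec lab X $ f"
    using vars unfolding qmst_variables_def by (auto simp: diag_vec_def vec_eq_iff)
  have "?P \<subseteq> {p. card p = 2}"
    by (auto simp: card_insert_if)
  then have "(\<Sum>p\<in>{p. card p = 2}. of_int (if p \<in> ?P then 1 else 0) * pair_entry Y p)
      = (\<Sum>p\<in>?P. pair_entry Y p)"
    by (intro sum.mono_neutral_cong_right) auto
  also have "\<dots> = (\<Sum>e\<in>D - {f}. pair_entry Y {f, e})"
    by (subst sum.reindex) (auto simp: inj_on_def doubleton_eq_iff)
  also have "\<dots> = (\<Sum>e\<in>D - {f}. Y $ f $ e)"
    by (simp add: pair_entry_eq[OF sym])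
  finally have pairs: "(\<Sum>p\<in>{p. card p = 2}. of_int (if p \<in> ?P then 1 else 0) * pair_entry Y p)
      = (\<Sum>e\<in>D - {f}. Y $ f $ e)" .
  have "(\<Sum>e\<in>UNIV. of_int (if e = f then (if f \<in> D then 0 else - 1) else 0) * edge_vec lab X $ e)
      = (\<Sum>e\<in>UNIV. if e = f then (if f \<in> D then 0 else - edge_vec lab X $ f) else 0)"
    by (intro sum.cong) auto
  also have "\<dots> = (if f \<in> D then 0 else - edge_vec lab X $ f)"
    by simp
  finally show ?thesis
    unfolding integer_form_def pairs
    by (cases "f \<in> D") (simp_all add: sum_diff1 diag)
qed

theorem proposition4:
  fixes E :: "'v::finite set set" and lab :: "'e::finite \<Rightarrow> 'v set" and i :: 'v and f :: 'e
  assumes "simple_graph E" and "connected_graph E" and "bij_betw lab UNIV E"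
  shows "chvatal_gomory_cut lab
           (\<lambda>X Y. (\<Sum>e\<in>incident_edges lab i. Y $ f $ e) - edge_vec lab X $ f) 0"
proof -
  define D where "D = incident_edges lab i"
  define b where "b = (beta CARD('v) - alpha CARD('v)) / (real CARD('e) + 1)"
  \<comment> \<open>The minimum ensures that the right-hand side rounds to \<open>0\<close> and not to a larger integer.\<close>
  define d where "d = min 0 (b - 1)"
  have range: "range lab = E" and inj: "inj lab"
    using assms(3) by (auto simp: bij_betw_def)
  then have simple: "simple_graph (range lab)"
    using assms(1) by simp
  then have "card (lab f) = 2"
    by (simp add: simple_graph_def)
  then have "2 \<le> CARD('v)"
    by (metis card_mono finite subset_UNIV)
  then have "0 < b"
    using beta_minus_alpha_pos by (simp add: b_def)
  then have "0 = \<lceil>d\<rceil>"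
    by (auto simp: d_def ceiling_unique)
  moreover have "d \<le> (\<Sum>e\<in>D. Y $ f $ e) - edge_vec lab X $ f" if relax: "qmst_relaxation lab X Y" for X Y
    using relaxation_cut_gap[OF relax simple inj, where i = i and f = f] by (simp add: d_def b_def D_def)
  moreover have "qmst_variables lab X Y" if "qmst_relaxation lab X Y" for X Y
    using that by (simp add: qmst_relaxation_def qmst_constraints_def)
  ultimately show ?thesis
    unfolding chvatal_gomory_cut_def D_def[symmetric]
    using integer_form_row_sum[of lab _ _ f D] by metis
qed

end
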